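(* Let $n\ge1$, $p_1,\dots,p_n\in(0,1)$, and let $m_1,\dots,m_n$ be positive integers. Consider the committee of $n$ experts with random votes $\mathbf{X}$, truth $Y$ and committee profile $\mathbf{K}=(k_1,\dots,k_n)$ described in the context, and let $\hat f^{\mathrm{HC}}$ be the plug-in rule $$\hat f^{\mathrm{HC}}(\mathbf{x},\mathbf{k})=\operatorname{sign}\left(\sum_{i=1}^n\hat w_i^{\mathrm{HC}}x_i\right),\qquad \hat w_i^{\mathrm{HC}}=\log\frac{\hat p_i}{1-\hat p_i},\quad \hat p_i=\frac{k_i}{m_i}.$$ Put $$\delta=\sum_{i=1}^n\frac{1}{\sqrt{m_i}}$$ and let $R$ be the event $$\exp\left(-\frac12\sum_{i=1}^n\left(\hat p_i-\tfrac12\right)\hat w_i^{\mathrm{HC}}\right)\le\frac{\delta}{2}.$$ Then $$\mathbb{P}\left(R\cap\left\{\hat f^{\mathrm{HC}}(\mathbf{X},\mathbf{K})\neq Y\right\}\right)\le\delta.$$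
   Context: Setting: $Y\in\{\pm1\}$ is uniform; $\mathbf{X}=(X_1,\dots,X_n)\in\{\pm1\}^n$ are the expert votes; the correctness indicators $\xi_i=\mathbf{1}\{X_i=Y\}$ are mutually independent and jointly independent of $Y$, with $\mathbb{P}(X_i=Y)=p_i$. In addition, expert $i$ has previously been queried independently $m_i$ times ($m_i$ fixed) and was correct $k_i$ times; thus the committee profile $\mathbf{K}=(k_1,\dots,k_n)$ has independent components $k_i\sim\mathrm{Binomial}(m_i,p_i)$ and is independent of $(\mathbf{X},Y)$. Weights may be infinite: $\hat w_i^{\mathrm{HC}}=+\infty$ if $\hat p_i=1$ and $-\infty$ if $\hat p_i=0$; in either case $(\hat p_i-\frac12)\hat w_i^{\mathrm{HC}}=+\infty$, and $\exp(-\infty)=0$. With $\eta_i=2\xi_i-1$, the error event $\{\hat f^{\mathrm{HC}}(\mathbf{X},\mathbf{K})\ne Y\}$ is the event that $\sum_{i=1}^n\hat w_i^{\mathrm{HC}}\eta_i\le0$ (ties count as errors) or that this sum involves $\infty-\infty$ (also counted as an error). *)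

theory Defs
  imports "HOL-Probability.Probability"
begin

definition exp_ereal :: "ereal \<Rightarrow> ereal" where
  "exp_ereal x =
     (if x = \<infinity> then \<infinity> else if x = -\<infinity> then 0 else ereal (exp (real_of_ereal x)))"

text \<open>
  In the library, \<^term>\<open>\<infinity> + (-\<infinity>) = (\<infinity> :: ereal)\<close>. Sums of weighted votes that
  involve both infinities are therefore detected explicitly.
\<close>

definition inf_clash :: "'i set \<Rightarrow> ('i \<Rightarrow> ereal) \<Rightarrow> bool" where
  "inf_clash I t \<longleftrightarrow> (\<exists>i\<in>I. t i = \<infinity>) \<and> (\<exists>j\<in>I. t j = -\<infinity>)"

definition p_hat :: "(nat \<Rightarrow> nat) \<Rightarrow> (nat \<Rightarrow> nat) \<Rightarrow> nat \<Rightarrow> real" where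
  "p_hat m k i = real (k i) / real (m i)"

definition w_HC :: "(nat \<Rightarrow> nat) \<Rightarrow> (nat \<Rightarrow> nat) \<Rightarrow> nat \<Rightarrow> ereal" where
  "w_HC m k i =
     (if p_hat m k i = 1 then \<infinity>
      else if p_hat m k i = 0 then -\<infinity>
      else ereal (ln (p_hat m k i / (1 - p_hat m k i))))"

text \<open>
  The rule takes values in \<open>{-1, 0, 1}\<close>. The value \<open>0\<close>, which differs from both labels,
  is returned on a tie (\<^term>\<open>sgn (0::ereal) = 0\<close>) and when the sum involves both infinities,
  so that both situations count as errors.
\<close>

definition f_HC :: "nat \<Rightarrow> (nat \<Rightarrow> nat) \<Rightarrow> (nat \<Rightarrow> int) \<Rightarrow> (nat \<Rightarrow> nat) \<Rightarrow> ereal" where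
  "f_HC n m x k =
     (if inf_clash {1..n} (\<lambda>i. w_HC m k i * ereal (of_int (x i))) then 0
      else sgn (\<Sum>i=1..n. w_HC m k i * ereal (of_int (x i))))"

definition correct :: "('a \<Rightarrow> int) \<Rightarrow> (nat \<Rightarrow> 'a \<Rightarrow> int) \<Rightarrow> nat \<Rightarrow> 'a \<Rightarrow> int" where
  "correct Y X i \<omega> = of_bool (X i \<omega> = Y \<omega>)"

text \<open>
  \<^const>\<open>prob_space.indep_var\<close> only relates random variables with values in the same type; this is
  the same notion for two types.
\<close>

definition (in prob_space) indep_rv ::
  "'b measure \<Rightarrow> ('a \<Rightarrow> 'b) \<Rightarrow> 'c measure \<Rightarrow> ('a \<Rightarrow> 'c) \<Rightarrow> bool" where
  "indep_rv S A T B \<longleftrightarrow>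
     random_variable S A \<and> random_variable T B \<and>
     indep_set
       (sigma_sets (space M) {A -` E \<inter> space M | E. E \<in> sets S})
       (sigma_sets (space M) {B -` E \<inter> space M | E. E \<in> sets T})"

lemma (in prob_space) indep_rv_iff_indep_var: "indep_rv S A T B \<longleftrightarrow> indep_var S A T B"
  by (simp add: indep_rv_def indep_var_eq)

locale committee = prob_space M
  for M :: "'a measure" +
  fixes n :: nat
    and p :: "nat \<Rightarrow> real"
    and m :: "nat \<Rightarrow> nat"
    and Y :: "'a \<Rightarrow> int"
    and X :: "nat \<Rightarrow> 'a \<Rightarrow> int"
    and K :: "nat \<Rightarrow> 'a \<Rightarrow> nat"
  assumes Y_values: "\<And>\<omega>. \<omega> \<in> space M \<Longrightarrow> Y \<omega> \<in> {-1, 1}"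
    and X_values: "\<And>i \<omega>. i \<in> {1..n} \<Longrightarrow> \<omega> \<in> space M \<Longrightarrow> X i \<omega> \<in> {-1, 1}"
    and Y_uniform: "distr M (count_space UNIV) Y = measure_pmf (pmf_of_set {-1, 1})"
    and correct_prob: "\<And>i. i \<in> {1..n} \<Longrightarrow> prob {\<omega> \<in> space M. X i \<omega> = Y \<omega>} = p i"
    and correct_indep: "indep_vars (\<lambda>_. count_space UNIV) (correct Y X) {1..n}"
    and Y_correct_indep:
      "indep_rv (count_space UNIV) Y
         (Pi\<^sub>M {1..n} (\<lambda>_. count_space UNIV)) (\<lambda>\<omega>. \<lambda>i\<in>{1..n}. correct Y X i \<omega>)"
    and K_binomial:
      "\<And>i. i \<in> {1..n} \<Longrightarrow>
         distr M (count_space UNIV) (K i) = measure_pmf (binomial_pmf (m i) (p i))"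
    and K_indep: "indep_vars (\<lambda>_. count_space UNIV) K {1..n}"
    and K_XY_indep:
      "indep_rv
         (Pi\<^sub>M {1..n} (\<lambda>_. count_space UNIV)) (\<lambda>\<omega>. \<lambda>i\<in>{1..n}. K i \<omega>)
         (Pi\<^sub>M {1..n} (\<lambda>_. count_space UNIV) \<Otimes>\<^sub>M count_space UNIV)
         (\<lambda>\<omega>. (\<lambda>i\<in>{1..n}. X i \<omega>, Y \<omega>))"

lemma weighted_HC_infinite:
  assumes "p_hat m k i = 0 \<or> p_hat m k i = 1"
  shows "ereal (p_hat m k i - 1/2) * w_HC m k i = \<infinity>"
  using assms by (auto simp: w_HC_def)

context committee
begin

lemma f_HC_error_iff:
  assumes \<omega>: "\<omega> \<in> space M"
  defines "t \<equiv> \<lambda>i. w_HC m (\<lambda>j. K j \<omega>) i * ereal (of_int (2 * correct Y X i \<omega> - 1))"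
  shows "f_HC n m (\<lambda>i. X i \<omega>) (\<lambda>i. K i \<omega>) \<noteq> ereal (of_int (Y \<omega>)) \<longleftrightarrow>
    (\<Sum>i=1..n. t i) \<le> 0 \<or> inf_clash {1..n} t"
proof -
  define s where "s = (\<lambda>i. w_HC m (\<lambda>j. K j \<omega>) i * ereal (of_int (X i \<omega>)))"
  have Y: "Y \<omega> = 1 \<or> Y \<omega> = -1" using Y_values[OF \<omega>] by auto
  have eta: "2 * correct Y X i \<omega> - 1 = X i \<omega> * Y \<omega>" if "i \<in> {1..n}" for i
    using X_values[OF that \<omega>] Y by (auto simp: correct_def)
  have st: "t i = s i * ereal (of_int (Y \<omega>))" if "i \<in> {1..n}" for i
    unfolding t_def s_def eta[OF that] of_int_mult times_ereal.simps(1)[symmetric]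
    by (simp only: ac_simps)
  have clash: "inf_clash {1..n} t \<longleftrightarrow> inf_clash {1..n} s"
    using Y by (auto simp: inf_clash_def st ereal_uminus_eq_reorder)
  have f: "f_HC n m (\<lambda>i. X i \<omega>) (\<lambda>i. K i \<omega>) = (if inf_clash {1..n} s then 0 else sgn (\<Sum>i=1..n. s i))"
    by (simp add: f_HC_def s_def)
  have sgn_iff: "sgn x \<noteq> 1 \<longleftrightarrow> x \<le> 0" "sgn x \<noteq> -1 \<longleftrightarrow> 0 \<le> x" for x :: ereal
    by (cases x; auto simp: sgn_if one_ereal_def)+
  have sum_MInf: "\<exists>i\<in>A. s i = -\<infinity>" if "sum s A = -\<infinity>" for A
  proof (rule ccontr)
    assume "\<not> ?thesis"
    then have "sum s A \<noteq> -\<infinity>"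
      by (induction A rule: infinite_finite_induct) auto
    then show False using that by simp
  qed
  have neg: "(\<Sum>i\<in>A. - s i) = - (\<Sum>i\<in>A. s i)" if "\<not> inf_clash A s" "finite A" for A
    using that(2,1)
  proof (induction A)
    case (insert a A)
    have "\<not> inf_clash A s" using insert.prems by (auto simp: inf_clash_def)
    moreover have "\<not> (s a = \<infinity> \<and> sum s A = -\<infinity>)" "\<not> (s a = -\<infinity> \<and> sum s A = \<infinity>)"
      using insert.prems insert.hyps by (auto simp: inf_clash_def sum_Pinfty dest!: sum_MInf)
    ultimately show ?case using insert
      by (cases "s a"; cases "sum s A") auto
  qed simp
  show ?thesis
  proof (cases "inf_clash {1..n} s")
    case True
    then show ?thesis using clash f Y by auto
  next
    case False
    show ?thesis
    proof (cases "Y \<omega> = 1")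
      case True
      then have "(\<Sum>i=1..n. t i) = (\<Sum>i=1..n. s i)" using st by simp
      then show ?thesis using True False clash f sgn_iff by (simp add: one_ereal_def)
    next
      case F: False
      then have "Y \<omega> = -1" using Y by auto
      then have "(\<Sum>i=1..n. t i) = - (\<Sum>i=1..n. s i)"
        using st neg[OF False] by (simp flip: one_ereal_def)
      moreover have "ereal (-1) = -1" by (simp add: one_ereal_def)
      ultimately show ?thesis using \<open>Y \<omega> = -1\<close> False clash f sgn_iff(2)[of "\<Sum>i=1..n. s i"]
        by simp
    qed
  qed
qed

lemma random_variables [measurable]:
  "Y \<in> measurable M (count_space UNIV)"
  "i \<in> {1..n} \<Longrightarrow> X i \<in> measurable M (count_space UNIV)"
  "i \<in> {1..n} \<Longrightarrow> K i \<in> measurable M (count_space UNIV)"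
proof -
  show "Y \<in> measurable M (count_space UNIV)"
    using Y_correct_indep by (simp add: indep_rv_def)
  show "K i \<in> measurable M (count_space UNIV)" if "i \<in> {1..n}"
    using K_indep that by (simp add: indep_vars_def)
  show "X i \<in> measurable M (count_space UNIV)" if i: "i \<in> {1..n}"
  proof -
    have "(\<lambda>\<omega>. (\<lambda>i\<in>{1..n}. X i \<omega>, Y \<omega>)) \<in>
        measurable M (Pi\<^sub>M {1..n} (\<lambda>_. count_space UNIV) \<Otimes>\<^sub>M count_space UNIV)"
      using K_XY_indep by (simp add: indep_rv_def)
    from measurable_compose[OF measurable_compose[OF this measurable_fst] measurable_component_singleton[OF i]]
    show ?thesis using i by simp
  qed
qed

lemma w_HC_measurable [measurable]:
  assumes "i \<in> {1..n}"
  shows "(\<lambda>\<omega>. w_HC m (\<lambda>j. K j \<omega>) i) \<in> borel_measurable M"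
proof -
  have "(\<lambda>\<omega>. (\<lambda>k. w_HC m (\<lambda>_. k) i) (K i \<omega>)) \<in> borel_measurable M"
    by (rule measurable_compose[OF random_variables(3)[OF assms]]) simp
  then show ?thesis unfolding w_HC_def p_hat_def .
qed

lemma p_hat_measurable [measurable]:
  assumes "i \<in> {1..n}"
  shows "(\<lambda>\<omega>. p_hat m (\<lambda>j. K j \<omega>) i) \<in> borel_measurable M"
  unfolding p_hat_def
  by (rule measurable_compose[OF random_variables(3)[OF assms]]) simp

lemma error_in_events:
  "{\<omega> \<in> space M. f_HC n m (\<lambda>i. X i \<omega>) (\<lambda>i. K i \<omega>) \<noteq> ereal (of_int (Y \<omega>))} \<in> events"
proof -
  have [measurable]: "correct Y X i \<in> measurable M (count_space UNIV)" if "i \<in> {1..n}" for i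
    using correct_indep that by (simp add: indep_vars_def)
  define t where
    "t = (\<lambda>i \<omega>. w_HC m (\<lambda>j. K j \<omega>) i * ereal (of_int (2 * correct Y X i \<omega> - 1)))"
  have [measurable]: "t i \<in> borel_measurable M" if i [measurable]: "i \<in> {1..n}" for i
    unfolding t_def by measurable
  have "{\<omega> \<in> space M. (\<Sum>i=1..n. t i \<omega>) \<le> 0 \<or>
      ((\<exists>i\<in>{1..n}. t i \<omega> = \<infinity>) \<and> (\<exists>j\<in>{1..n}. t j \<omega> = -\<infinity>))} \<in> events"
    by measurable
  also have "{\<omega> \<in> space M. (\<Sum>i=1..n. t i \<omega>) \<le> 0 \<or>
      ((\<exists>i\<in>{1..n}. t i \<omega> = \<infinity>) \<and> (\<exists>j\<in>{1..n}. t j \<omega> = -\<infinity>))} =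
      {\<omega> \<in> space M. f_HC n m (\<lambda>i. X i \<omega>) (\<lambda>i. K i \<omega>) \<noteq> ereal (of_int (Y \<omega>))}"
    using f_HC_error_iff by (auto simp: t_def inf_clash_def)
  finally show ?thesis .
qed

lemma R_in_events:
  "{\<omega> \<in> space M. exp_ereal (- (ereal (1/2) *
      (\<Sum>i=1..n. ereal (p_hat m (\<lambda>j. K j \<omega>) i - 1/2) * w_HC m (\<lambda>j. K j \<omega>) i))) \<le> c} \<in> events"
proof -
  have [measurable]: "exp_ereal \<in> borel_measurable borel"
    unfolding exp_ereal_def [abs_def] by measurable
  show ?thesis by measurable
qed

end

end

theory Submission
  imports Defs
begin

text \<open>
  Fix the profile \<open>k\<close> and pretend that the experts' true competences are the empirical ones
  \<open>q\<^sub>i = k\<^sub>i / m\<^sub>i\<close>. The plug-in weights are then the optimal ones, and the Chernoff bound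
  with exponent \<open>1/2\<close> bounds the error probability by the product of the terms
  \<open>2 * sqrt (q\<^sub>i * (1 - q\<^sub>i)) \<le> exp (- (q\<^sub>i - 1/2) * w\<^sub>i / 2)\<close>, that is, by \<open>\<delta> / 2\<close> on \<open>R\<close>.
  Passing from \<open>q\<close> back to \<open>p\<close> costs at most the total variation distance of the two product
  measures, hence at most \<open>\<Sum>i. \<bar>p\<^sub>i - q\<^sub>i\<bar>\<close>. Averaged over the profile, each summand is at most
  \<open>sqrt (p\<^sub>i * (1 - p\<^sub>i) / m\<^sub>i) \<le> 1 / (2 * sqrt m\<^sub>i)\<close>, which yields the other \<open>\<delta> / 2\<close>.
\<close>


section \<open>The Chernoff factor of a single expert\<close>

text \<open>The negated left side \<open>G\<close> is convex and symmetric under x -> 1 - x, so its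
  minimum is at 1/2, where it equals ln 2. The inequality is the logarithm of 2 * sqrt (q * (1 - q))
  \<le> exp (- (q - 1/2) * w / 2), with w the log-odds of q.\<close>

lemma binary_entropy_tilt:
  fixes q :: real
  assumes "0 < q" "q < 1"
  shows "(q / 2 + 1 / 4) * ln q + (3 / 4 - q / 2) * ln (1 - q) \<le> - ln 2"
proof -
  define G :: "real \<Rightarrow> real" where
    "G = (\<lambda>x. - (x / 2 + 1 / 4) * ln x - (3 / 4 - x / 2) * ln (1 - x))"
  have "convex_on {0<..<1} G"
  proof (rule f''_ge0_imp_convex)
    fix x :: real assume x: "x \<in> {0<..<1}"
    have "(G has_field_derivative (- (1 / 2) * ln x - (x / 2 + 1 / 4) * (1 / x))
        - (- (1 / 2) * ln (1 - x) - (3 / 4 - x / 2) * (1 / (1 - x)))) (at x)"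
      unfolding G_def using x
      by (auto intro!: derivative_eq_intros simp: diff_divide_distrib add_divide_distrib)
    also have "(- (1 / 2) * ln x - (x / 2 + 1 / 4) * (1 / x))
        - (- (1 / 2) * ln (1 - x) - (3 / 4 - x / 2) * (1 / (1 - x))) =
        (ln (1 - x) - ln x) / 2 + (inverse (1 - x) - inverse x) / 4"
      using x by (simp add: divide_simps) (simp add: algebra_simps)
    finally show "(G has_field_derivative
        (ln (1 - x) - ln x) / 2 + (inverse (1 - x) - inverse x) / 4) (at x)" .
    have "((\<lambda>x. (ln (1 - x) - ln x) / 2 + (inverse (1 - x) - inverse x) / 4) has_field_derivative
        (- inverse (1 - x) - inverse x) / 2 + ((inverse (1 - x))\<^sup>2 + (inverse x)\<^sup>2) / 4) (at x)"
    proof -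
      have "((\<lambda>x. ln (1 - x)) has_field_derivative - inverse (1 - x)) (at x)"
        "(ln has_field_derivative inverse x) (at x)"
        "((\<lambda>x. inverse (1 - x)) has_field_derivative (inverse (1 - x))\<^sup>2) (at x)"
        "(inverse has_field_derivative - (inverse x)\<^sup>2) (at x)"
        using x by (auto intro!: derivative_eq_intros simp: inverse_eq_divide power2_eq_square)
      from DERIV_add[OF DERIV_cdivide[OF DERIV_diff[OF this(1,2)], of 2]
          DERIV_cdivide[OF DERIV_diff[OF this(3,4)], of 4]]
      show ?thesis by simp
    qed
    also have "(- inverse (1 - x) - inverse x) / 2 + ((inverse (1 - x))\<^sup>2 + (inverse x)\<^sup>2) / 4 =
        ((inverse (1 - x) - inverse x) / 2)\<^sup>2"
    proof -
      \<comment> \<open>Sum and product of the two reciprocals coincide, so the linear part of the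
        second derivative becomes the cross term of a perfect square.\<close>
      have "inverse (1 - x) + inverse x = inverse (1 - x) * inverse x"
        using x by (simp add: field_simps)
      moreover have "(- a - b) / 2 + (a\<^sup>2 + b\<^sup>2) / 4 = ((a - b) / 2)\<^sup>2"
        if "a + b = a * b" for a b :: real
      proof -
        have "((a - b) / 2)\<^sup>2 = (a\<^sup>2 + b\<^sup>2) / 4 - (a * b) / 2"
          by (simp add: power2_diff power_divide diff_divide_distrib)
        then show ?thesis
          by (simp flip: that add: add_divide_distrib diff_divide_distrib)
      qed
      ultimately show ?thesis by blast
    qed
    finally show "((\<lambda>x. (ln (1 - x) - ln x) / 2 + (inverse (1 - x) - inverse x) / 4)
        has_field_derivative ((inverse (1 - x) - inverse x) / 2)\<^sup>2) (at x)" .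
  qed auto
  \<comment> \<open>The midpoint of \<open>q\<close> and \<open>1 - q\<close> is 1/2.\<close>
  from convex_onD[OF this, of "1/2" q "1 - q"] assms
  have "G (1 / 2) \<le> (G q + G (1 - q)) / 2"
    by (simp add: field_simps)
  also have "G (1 - q) = G q"
    by (simp add: G_def algebra_simps diff_divide_distrib)
  finally show ?thesis
    by (simp add: G_def ln_div algebra_simps)
qed

text \<open>The log-odds weight balances the two summands: both equal sqrt (q * (1 - q)). What
  remains is \<open>binary_entropy_tilt\<close>, exponentiated.\<close>

lemma chernoff_factor_le:
  fixes q :: real
  assumes q: "0 < q" "q < 1"
  defines "w \<equiv> ln (q / (1 - q))"
  shows "q * exp (- (w / 2)) + (1 - q) * exp (w / 2) \<le> exp (- ((q - 1 / 2) * w / 2))"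
proof -
  have w: "w = ln q - ln (1 - q)"
    using q by (simp add: w_def ln_div)
  have "q * exp (- (w / 2)) = exp (ln q - w / 2)" "(1 - q) * exp (w / 2) = exp (ln (1 - q) + w / 2)"
    using q by (simp_all add: exp_add flip: add_uminus_conv_diff)
  moreover have "ln q - w / 2 = (ln q + ln (1 - q)) / 2" "ln (1 - q) + w / 2 = (ln q + ln (1 - q)) / 2"
    by (simp_all add: w diff_divide_distrib add_divide_distrib)
  ultimately have "q * exp (- (w / 2)) + (1 - q) * exp (w / 2) = 2 * exp ((ln q + ln (1 - q)) / 2)"
    by simp
  also have "\<dots> = exp (ln 2 + (ln q + ln (1 - q)) / 2)"
    by (simp add: exp_add)
  also have "\<dots> \<le> exp (- ((q - 1 / 2) * w / 2))"
    using binary_entropy_tilt[OF q]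
    by (simp add: w algebra_simps add_divide_distrib diff_divide_distrib)
  finally show ?thesis .
qed

section \<open>Product Bernoulli weights on the subsets of a finite set\<close>

text \<open>
  The expectation of \<open>f S\<close> for the random set \<open>S \<subseteq> A\<close> that contains each \<open>i\<close> independently with
  probability \<open>p i\<close>; below, \<open>S\<close> is the set of experts that vote correctly.
\<close>

definition bern_sum :: "'i set \<Rightarrow> ('i \<Rightarrow> real) \<Rightarrow> ('i set \<Rightarrow> real) \<Rightarrow> real" where
  "bern_sum A p f = (\<Sum>S\<in>Pow A. f S * ((\<Prod>i\<in>S. p i) * (\<Prod>i\<in>A - S. 1 - p i)))"

text \<open>Conditions on whether \<open>a\<close> belongs to the random set. The factors
  \<open>p a\<close> and \<open>1 - p a\<close> are absorbed into the integrand, so an induction on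
  \<open>A\<close> can run with \<open>f\<close> arbitrary.\<close>

lemma bern_sum_insert:
  assumes "finite A" "a \<notin> A"
  shows "bern_sum (insert a A) p f = bern_sum A p (\<lambda>S. p a * f (insert a S) + (1 - p a) * f S)"
proof -
  have "bern_sum (insert a A) p f =
      (\<Sum>S\<in>Pow A. f S * (prod p S * (\<Prod>i\<in>insert a A - S. 1 - p i))) +
      (\<Sum>S\<in>insert a ` Pow A. f S * (prod p S * (\<Prod>i\<in>insert a A - S. 1 - p i)))"
    unfolding bern_sum_def Pow_insert by (rule sum.union_disjoint) (use assms in auto)
  also have "(\<Sum>S\<in>insert a ` Pow A. f S * (prod p S * (\<Prod>i\<in>insert a A - S. 1 - p i))) =
      (\<Sum>S\<in>Pow A. f (insert a S) * (prod p (insert a S) * (\<Prod>i\<in>insert a A - insert a S. 1 - p i)))"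
    by (subst sum.reindex) (use assms in \<open>auto intro!: inj_onI simp: o_def\<close>)
  also have "\<dots> = (\<Sum>S\<in>Pow A. p a * f (insert a S) * (prod p S * (\<Prod>i\<in>A - S. 1 - p i)))"
    by (rule sum.cong[OF refl], subst prod.insert)
      (use assms in \<open>auto intro: finite_subset simp: mult_ac\<close>)
  also have "(\<Sum>S\<in>Pow A. f S * (prod p S * (\<Prod>i\<in>insert a A - S. 1 - p i))) =
      (\<Sum>S\<in>Pow A. (1 - p a) * f S * (prod p S * (\<Prod>i\<in>A - S. 1 - p i)))"
  proof (rule sum.cong[OF refl])
    fix S assume "S \<in> Pow A"
    then have "insert a A - S = insert a (A - S)" "a \<notin> A - S" "finite (A - S)"
      using assms by auto
    then show "f S * (prod p S * (\<Prod>i\<in>insert a A - S. 1 - p i)) =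
        (1 - p a) * f S * (prod p S * (\<Prod>i\<in>A - S. 1 - p i))"
      by simp
  qed
  finally show ?thesis
    by (simp add: bern_sum_def distrib_right sum.distrib)
qed

lemma bern_sum_mono:
  assumes "\<And>i. i \<in> A \<Longrightarrow> 0 \<le> p i \<and> p i \<le> 1" "\<And>S. S \<subseteq> A \<Longrightarrow> f S \<le> g S"
  shows "bern_sum A p f \<le> bern_sum A p g"
  unfolding bern_sum_def
  by (intro sum_mono mult_right_mono mult_nonneg_nonneg prod_nonneg) (use assms in auto)

text \<open>Independence of the coordinates: multiplying out the product of two-term sums gives one
  term per subset \<open>S\<close>, with the first summand chosen exactly on
  \<open>S\<close>.\<close>

lemma bern_sum_prod:
  assumes "finite A"
  shows "bern_sum A p (\<lambda>S. \<Prod>i\<in>A. if i \<in> S then g i else h i) = (\<Prod>i\<in>A. p i * g i + (1 - p i) * h i)"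
proof -
  have "(\<Prod>i\<in>A. if i \<in> S then g i else h i) = (\<Prod>i\<in>S. g i) * (\<Prod>i\<in>A - S. h i)" if "S \<subseteq> A" for S
    using that assms by (simp add: prod.If_cases Int_absorb1 Diff_eq)
  then show ?thesis
    unfolding bern_sum_def prod_add[OF assms]
    by (intro sum.cong) (auto simp: prod.distrib mult_ac)
qed

lemma bern_sum_const: "finite A \<Longrightarrow> bern_sum A p (\<lambda>_. c) = c"
  using bern_sum_prod[of A p "\<lambda>_. 1" "\<lambda>_. 1"]
  by (simp add: bern_sum_def flip: sum_distrib_left)

text \<open>The parameters \<open>p\<close> are replaced by \<open>q\<close> one coordinate at a time.\<close>

lemma bern_sum_diff_le:
  assumes "finite A"
    and "\<And>i. i \<in> A \<Longrightarrow> 0 \<le> p i \<and> p i \<le> 1" "\<And>i. i \<in> A \<Longrightarrow> 0 \<le> q i \<and> q i \<le> 1"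
    and "\<And>S. 0 \<le> f S \<and> f S \<le> 1"
  shows "bern_sum A p f - bern_sum A q f \<le> (\<Sum>i\<in>A. \<bar>p i - q i\<bar>)"
  using assms
proof (induction A arbitrary: f rule: finite_induct)
  case empty
  then show ?case by (simp add: bern_sum_def)
next
  case (insert a A)
  let ?f = "\<lambda>r S. r * f (insert a S) + (1 - r) * f S"
  \<comment> \<open>Averaging over coordinate \<open>a\<close> keeps the integrand in [0, 1], so the
    induction hypothesis applies to it.\<close>
  have "0 \<le> ?f r S \<and> ?f r S \<le> 1" if "0 \<le> r" "r \<le> 1" for r S
    using insert.prems(3)[of S] insert.prems(3)[of "insert a S"] that
    by (auto intro!: convex_bound_le)
  then have "bern_sum A p (?f (p a)) - bern_sum A q (?f (p a)) \<le> (\<Sum>i\<in>A. \<bar>p i - q i\<bar>)"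
    using insert.prems by (intro insert.IH) auto
  \<comment> \<open>Exchanging \<open>p a\<close> for \<open>q a\<close> changes the integrand by
    \<open>(p a - q a) * (f (insert a S) - f S)\<close>, whose second factor lies in
    [-1, 1].\<close>
  moreover have "bern_sum A q (?f (p a)) \<le> bern_sum A q (\<lambda>S. ?f (q a) S + \<bar>p a - q a\<bar>)"
  proof (rule bern_sum_mono)
    fix S
    have "?f (p a) S - ?f (q a) S = (p a - q a) * (f (insert a S) - f S)"
      by (simp add: algebra_simps)
    also have "\<dots> \<le> \<bar>p a - q a\<bar> * 1"
      using insert.prems(3)[of S] insert.prems(3)[of "insert a S"]
      by (intro order.trans[OF abs_ge_self[of "(p a - q a) * (f (insert a S) - f S)"]])
        (unfold abs_mult, intro mult_left_mono, auto)
    finally show "?f (p a) S \<le> ?f (q a) S + \<bar>p a - q a\<bar>" by simp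
  qed (use insert.prems in auto)
  moreover have "bern_sum A q (\<lambda>S. ?f (q a) S + \<bar>p a - q a\<bar>) =
      bern_sum A q (?f (q a)) + bern_sum A q (\<lambda>_. \<bar>p a - q a\<bar>)"
    by (simp only: bern_sum_def distrib_right sum.distrib)
  ultimately show ?case
    unfolding bern_sum_insert[OF insert.hyps] sum.insert[OF insert.hyps] bern_sum_const[OF insert.hyps(1)]
    by linarith
qed

section \<open>Mean absolute deviation of an empirical frequency\<close>

text \<open>The variance of k / m is p * (1 - p) / m \<le> 1 / (4 * m). A scaled AM-GM inequality
  passes from the second moment to the first absolute moment; each of its two terms contributes at
  most 1 / (4 * sqrt m).\<close>

lemma binomial_mean_abs_deviation:
  assumes p: "0 < p" "p < 1" and "0 < m"
  shows "measure_pmf.expectation (binomial_pmf m p) (\<lambda>k. \<bar>p - real k / real m\<bar>) \<le> 1 / (2 * sqrt (real m))"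
proof -
  have sq: "(\<Sum>k\<le>m. (p - real k / real m)\<^sup>2 * Bernstein m k p) = p * (1 - p) / m"
  proof -
    \<comment> \<open>Splits the square into multiples of \<open>a * (a - 1)\<close>,
      \<open>a\<close> and 1, whose Bernstein sums have closed forms.\<close>
    have *: "(a - b)\<^sup>2 * x = a * (a - 1) * x + (1 - 2 * b) * a * x + b * b * x" for a b x :: real
      by (simp add: algebra_simps power2_eq_square)
    have "(\<Sum>k\<le>m. (real k - m * p)\<^sup>2 * Bernstein m k p) =
        (\<Sum>k\<le>m. real k * (real k - 1) * Bernstein m k p) +
        (1 - 2 * (m * p)) * (\<Sum>k\<le>m. real k * Bernstein m k p) +
        (m * p) * (m * p) * (\<Sum>k\<le>m. Bernstein m k p)"
      unfolding * sum.distrib sum_distrib_left by (simp only: mult.assoc)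
    also have "\<dots> = m * p * (1 - p)"
      unfolding sum_k_Bernstein sum_kk_Bernstein sum_Bernstein
      by (simp add: algebra_simps power2_eq_square)
    also have "(\<Sum>k\<le>m. (real k - m * p)\<^sup>2 * Bernstein m k p) =
        (real m)\<^sup>2 * (\<Sum>k\<le>m. (p - real k / real m)\<^sup>2 * Bernstein m k p)"
      unfolding sum_distrib_left using \<open>0 < m\<close>
      by (intro sum.cong) (auto simp: field_simps power2_eq_square)
    finally have "(real m)\<^sup>2 * (\<Sum>k\<le>m. (p - real k / real m)\<^sup>2 * Bernstein m k p) =
        (real m)\<^sup>2 * (p * (1 - p) / m)"
      using \<open>0 < m\<close> by (simp add: power2_eq_square)
    then show ?thesis
      unfolding mult_cancel_left using \<open>0 < m\<close> by simp
  qed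
  \<comment> \<open>Equality holds at \<bar>d\<bar> = 1 / (2 * sqrt m), the largest possible
    standard deviation; this fixes the scale sqrt m.\<close>
  have dev: "\<bar>d\<bar> \<le> sqrt m * d\<^sup>2 + 1 / (4 * sqrt m)" for d :: real
  proof -
    have "0 \<le> (2 * sqrt m * \<bar>d\<bar> - 1)\<^sup>2 / (4 * sqrt m)" by simp
    also have "\<dots> = sqrt m * d\<^sup>2 + 1 / (4 * sqrt m) - \<bar>d\<bar>"
    proof -
      have "(2 * s * \<bar>d\<bar> - 1)\<^sup>2 / (4 * s) = s * d\<^sup>2 + 1 / (4 * s) - \<bar>d\<bar>" if "s > 0" for s :: real
      proof -
        have "(2 * s * \<bar>d\<bar> - 1)\<^sup>2 = (s * d\<^sup>2 - \<bar>d\<bar>) * (4 * s) + 1"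
          by (simp add: power2_diff power_mult_distrib) (simp add: algebra_simps power2_eq_square)
        then show ?thesis
          using that by (simp add: add_divide_distrib)
      qed
      then show ?thesis
        using \<open>0 < m\<close> by simp
    qed
    finally show ?thesis by simp
  qed
  have "measure_pmf.expectation (binomial_pmf m p) (\<lambda>k. \<bar>p - real k / real m\<bar>) =
      (\<Sum>k\<le>m. \<bar>p - real k / real m\<bar> * Bernstein m k p)"
    using p by (subst expectation_binomial_pmf') (auto simp: Bernstein_def mult_ac)
  also have "\<dots> \<le> (\<Sum>k\<le>m. (sqrt m * (p - real k / real m)\<^sup>2 + 1 / (4 * sqrt m)) * Bernstein m k p)"
    using p by (intro sum_mono mult_right_mono dev Bernstein_nonneg) auto
  also have "\<dots> = sqrt m * (p * (1 - p) / m) + 1 / (4 * sqrt m)"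
    by (simp add: distrib_right sum.distrib mult.assoc sq
        del: times_divide_eq_left flip: sum_distrib_left)
  also have "\<dots> \<le> sqrt m * ((1 / 4) / m) + 1 / (4 * sqrt m)"
  proof -
    have "p * (1 - p) \<le> 1 / 4"
      using zero_le_power2[of "p - 1 / 2"] by (simp add: algebra_simps power2_eq_square)
    then show ?thesis
      by (intro add_right_mono mult_left_mono divide_right_mono) auto
  qed
  also have "sqrt m * ((1 / 4) / m) = 1 / (4 * sqrt m)"
    using \<open>0 < m\<close> by (simp add: field_simps)
  finally show ?thesis by simp
qed


section \<open>The error for a fixed profile\<close>

declare One_nat_def [simp del]

text \<open>The error event as a predicate of a deterministic profile \<open>k\<close> and the set
  \<open>T\<close> of correct experts. This separates the two independent sources of randomness; the
  sign attached to expert \<open>i\<close> is \<eta>_i.\<close>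

definition hc_error :: "nat \<Rightarrow> (nat \<Rightarrow> nat) \<Rightarrow> (nat \<Rightarrow> nat) \<Rightarrow> nat set \<Rightarrow> bool" where
  "hc_error n m k T \<longleftrightarrow>
     (\<Sum>i=1..n. w_HC m k i * ereal (if i \<in> T then 1 else - 1)) \<le> 0 \<or>
     inf_clash {1..n} (\<lambda>i. w_HC m k i * ereal (if i \<in> T then 1 else - 1))"

definition hc_exponent :: "nat \<Rightarrow> (nat \<Rightarrow> nat) \<Rightarrow> (nat \<Rightarrow> nat) \<Rightarrow> ereal" where
  "hc_exponent n m k =
     - (ereal (1/2) * (\<Sum>i=1..n. ereal (p_hat m k i - 1/2) * w_HC m k i))"

lemma inf_clash_cong: "(\<And>i. i \<in> I \<Longrightarrow> s i = t i) \<Longrightarrow> inf_clash I s \<longleftrightarrow> inf_clash I t"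
  by (simp add: inf_clash_def)

text \<open>Together with \<open>hc_error_cong\<close>, this allows the random profile to be
  replaced by a fixed \<open>k\<close> that agrees with it on \<open>{1..n}\<close>.\<close>

lemma hc_exponent_cong:
  assumes "\<And>i. i \<in> {1..n} \<Longrightarrow> k i = k' i"
  shows "hc_exponent n m k = hc_exponent n m k'"
proof -
  have t: "ereal (p_hat m k i - 1/2) * w_HC m k i = ereal (p_hat m k' i - 1/2) * w_HC m k' i"
    if "i \<in> {1..n}" for i
    using assms[OF that] by (simp add: w_HC_def p_hat_def)
  show ?thesis
    unfolding hc_exponent_def by (simp only: sum.cong[OF refl t])
qed

lemma hc_error_cong:
  assumes "\<And>i. i \<in> {1..n} \<Longrightarrow> k i = k' i"
  shows "hc_error n m k = hc_error n m k'"
proof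
  fix T
  have "w_HC m k i * ereal (if i \<in> T then 1 else - 1) =
      w_HC m k' i * ereal (if i \<in> T then 1 else - 1)" if "i \<in> {1..n}" for i
    using assms[OF that] by (simp add: w_HC_def p_hat_def)
  note t = this
  show "hc_error n m k T = hc_error n m k' T"
    unfolding hc_error_def by (simp only: sum.cong[OF refl t] inf_clash_cong[OF t])
qed

text \<open>If the true competences were the empirical ones, infinite weights would never mislead,
  and for finite weights the Chernoff bound with exponent 1/2 gives the product of the factors in
  \<open>chernoff_factor_le\<close>, which the hypothesis on \<open>hc_exponent\<close> bounds by
  \<open>c\<close>.\<close>

lemma empirical_error_le:
  assumes mk: "\<And>i. i \<in> {1..n} \<Longrightarrow> 0 < m i \<and> k i \<le> m i"
    and R: "exp_ereal (hc_exponent n m k) \<le> ereal c" and "0 \<le> c"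
  shows "bern_sum {1..n} (p_hat m k) (\<lambda>T. of_bool (hc_error n m k T)) \<le> c"
proof (cases "\<exists>j\<in>{1..n}. p_hat m k j = 0 \<or> p_hat m k j = 1")
  case True
  then obtain j where j: "j \<in> {1..n}" "p_hat m k j = 0 \<or> p_hat m k j = 1" by blast
  have "prod (p_hat m k) T * (\<Prod>i\<in>{1..n} - T. 1 - p_hat m k i) = 0"
    if T: "T \<subseteq> {1..n}" and err: "hc_error n m k T" for T
  proof (rule ccontr)
    assume nz: "prod (p_hat m k) T * (\<Prod>i\<in>{1..n} - T. 1 - p_hat m k i) \<noteq> 0"
    define t where "t = (\<lambda>i. w_HC m k i * ereal (if i \<in> T then 1 else - 1))"
    have err': "(\<Sum>i=1..n. t i) \<le> 0 \<or> inf_clash {1..n} t"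
      using err by (simp add: hc_error_def t_def)
    have "finite T" using T finite_subset by blast
    then have "\<forall>i\<in>T. p_hat m k i \<noteq> 0" "\<forall>i\<in>{1..n} - T. p_hat m k i \<noteq> 1"
      using nz by auto
    \<comment> \<open>In a set \<open>T\<close> of nonzero weight, experts with empirical frequency
      1 are correct and those with frequency 0 are wrong. Every infinite weight thus contributes
      +\<infinity>, which excludes both a clash and a nonpositive sum.\<close>
    then have pos: "p_hat m k i \<noteq> (if i \<in> T then 0 else 1)" if "i \<in> {1..n}" for i
      using that by auto
    have "t i \<noteq> - \<infinity>" if "i \<in> {1..n}" for i
      using pos[of i] that by (auto simp: t_def w_HC_def split: if_splits)
    moreover have "t j = \<infinity>"
      using pos[of j] j by (auto simp: t_def w_HC_def split: if_splits)
    ultimately show False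
      using err' j(1) sum_Pinfty[of t "{1..n}"] by (auto simp: inf_clash_def)
  qed
  then have "bern_sum {1..n} (p_hat m k) (\<lambda>T. of_bool (hc_error n m k T)) = 0"
    unfolding bern_sum_def by (intro sum.neutral ballI) (metis PowD mult_eq_0_iff of_bool_eq(1))
  then show ?thesis
    using \<open>0 \<le> c\<close> by simp
next
  case False
  define q where "q = p_hat m k"
  define w where "w = (\<lambda>i. ln (q i / (1 - q i)))"
  have q01: "0 \<le> q i \<and> q i \<le> 1" if "i \<in> {1..n}" for i
    using mk[OF that] by (simp add: q_def p_hat_def)
  have q: "0 < q i" "q i < 1" if "i \<in> {1..n}" for i
    using q01[OF that] False that by (auto simp: q_def less_le)
  have w: "w_HC m k i = ereal (w i)" if "i \<in> {1..n}" for i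
    using q[OF that] by (simp add: w_HC_def w_def q_def)
  have "hc_exponent n m k = ereal (- ((\<Sum>i=1..n. (q i - 1 / 2) * w i) / 2))"
    using w by (simp add: hc_exponent_def q_def)
  with R have R': "exp (- ((\<Sum>i=1..n. (q i - 1 / 2) * w i) / 2)) \<le> c"
    by (simp add: exp_ereal_def)
  \<comment> \<open>The indicator of a nonpositive weighted sum s is at most exp (- s / 2), which
    factorises over the experts.\<close>
  have "bern_sum {1..n} q (\<lambda>T. of_bool (hc_error n m k T)) \<le>
      bern_sum {1..n} q (\<lambda>T. \<Prod>i\<in>{1..n}. if i \<in> T then exp (- (w i / 2)) else exp (w i / 2))"
  proof (rule bern_sum_mono[OF q01])
    fix T :: "nat set"
    define s where "s = (\<lambda>i. w i * (if i \<in> T then 1 else - 1))"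
    have t: "w_HC m k i * ereal (if i \<in> T then 1 else - 1) = ereal (s i)" if "i \<in> {1..n}" for i
      unfolding w[OF that] s_def by simp
    have "(\<Prod>i\<in>{1..n}. if i \<in> T then exp (- (w i / 2)) else exp (w i / 2)) =
        exp (- (\<Sum>i=1..n. s i) / 2)"
      unfolding sum_negf[symmetric] sum_divide_distrib
      by (subst exp_sum) (auto simp: s_def intro!: prod.cong)
    moreover have "(\<Sum>i=1..n. s i) \<le> 0" if "hc_error n m k T"
      using that t by (auto simp: hc_error_def inf_clash_def)
    ultimately show "of_bool (hc_error n m k T) \<le>
        (\<Prod>i\<in>{1..n}. if i \<in> T then exp (- (w i / 2)) else exp (w i / 2))"
      by auto
  qed
  also have "\<dots> = (\<Prod>i\<in>{1..n}. q i * exp (- (w i / 2)) + (1 - q i) * exp (w i / 2))"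
    by (rule bern_sum_prod) simp
  also have "\<dots> \<le> (\<Prod>i\<in>{1..n}. exp (- ((q i - 1 / 2) * w i / 2)))"
    unfolding w_def using q
    by (intro prod_mono conjI chernoff_factor_le add_nonneg_nonneg mult_nonneg_nonneg)
      (auto intro: less_imp_le)
  also have "\<dots> = exp (- ((\<Sum>i=1..n. (q i - 1 / 2) * w i) / 2))"
    unfolding sum_negf[symmetric] sum_divide_distrib by (simp add: exp_sum)
  finally show ?thesis
    using R' by (simp add: q_def)
qed

section \<open>The random set of correct experts\<close>

text \<open>Only finitely many values occur, and each fibre is a finite conjunction of measurable
  conditions. Used on \<open>M\<close> and on the value space of votes and truth.\<close>

lemma measurable_finite_Collect:
  assumes "finite I" and Q [measurable]: "\<And>i. i \<in> I \<Longrightarrow> Measurable.pred N (Q i)"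
  shows "(\<lambda>z. {i \<in> I. Q i z}) \<in> measurable N (count_space UNIV)"
proof -
  have "(\<lambda>z. {i \<in> I. Q i z}) -` {T} \<inter> space N \<in> sets N" if "T \<subseteq> I" for T
  proof -
    have "(\<lambda>z. {i \<in> I. Q i z}) -` {T} \<inter> space N = {z \<in> space N. \<forall>i\<in>I. Q i z \<longleftrightarrow> i \<in> T}"
      using that by auto
    also have "\<dots> \<in> sets N"
      using \<open>finite I\<close> by measurable
    finally show ?thesis .
  qed
  then have "(\<lambda>z. {i \<in> I. Q i z}) \<in> measurable N (count_space (Pow I))"
    using \<open>finite I\<close> by (simp add: measurable_count_space_eq2)
  from measurable_compose[OF this, of "\<lambda>T. T" "count_space UNIV"] show ?thesis
    by simp
qed

context committee
begin

text \<open>For a given profile, the error event depends on votes and truth only through this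
  set.\<close>

definition correct_set :: "'a \<Rightarrow> nat set" where
  "correct_set \<omega> = {i \<in> {1..n}. X i \<omega> = Y \<omega>}"

text \<open>The event prescribes every correctness indicator, and these are independent. The
  assumption \<open>n \<ge> 1\<close> makes the index set of the intersection nonempty.\<close>

lemma prob_correct_set_eq:
  assumes "n \<ge> 1" "T \<subseteq> {1..n}"
  shows "prob {\<omega> \<in> space M. correct_set \<omega> = T} = prod p T * (\<Prod>i\<in>{1..n} - T. 1 - p i)"
proof -
  let ?v = "\<lambda>i. if i \<in> T then 1 else 0 :: int"
  have "{\<omega> \<in> space M. correct_set \<omega> = T} = (\<Inter>i\<in>{1..n}. correct Y X i -` {?v i} \<inter> space M)"
    using assms by (auto simp: correct_set_def correct_def split: if_splits)
  then have "prob {\<omega> \<in> space M. correct_set \<omega> = T} =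
      (\<Prod>i\<in>{1..n}. prob (correct Y X i -` {?v i} \<inter> space M))"
    using indep_varsD_finite[OF correct_indep, of "\<lambda>i. {?v i}"] assms by simp
  also have "\<dots> = (\<Prod>i\<in>{1..n}. if i \<in> T then p i else 1 - p i)"
  proof (rule prod.cong[OF refl])
    fix i assume i: "i \<in> {1..n}"
    note [measurable] = random_variables(1) random_variables(2)[OF i]
    have ev: "{\<omega> \<in> space M. X i \<omega> = Y \<omega>} \<in> events" by measurable
    have "correct Y X i -` {1} \<inter> space M = {\<omega> \<in> space M. X i \<omega> = Y \<omega>}"
      "correct Y X i -` {0} \<inter> space M = space M - {\<omega> \<in> space M. X i \<omega> = Y \<omega>}"
      by (auto simp: correct_def)
    then show "prob (correct Y X i -` {?v i} \<inter> space M) = (if i \<in> T then p i else 1 - p i)"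
      using prob_compl[OF ev] correct_prob[OF i] by simp
  qed
  also have "\<dots> = prod p T * (\<Prod>i\<in>{1..n} - T. 1 - p i)"
    using assms by (simp add: prod.If_cases Int_absorb1 Diff_eq)
  finally show ?thesis .
qed

lemma correct_set_measurable [measurable]:
  "correct_set \<in> measurable M (count_space UNIV)"
  unfolding correct_set_def[abs_def]
proof (rule measurable_finite_Collect)
  fix i assume "i \<in> {1..n}"
  from random_variables(1) random_variables(2)[OF this]
  show "Measurable.pred M (\<lambda>\<omega>. X i \<omega> = Y \<omega>)" by measurable
qed simp

text \<open>Identifies the law of \<open>correct_set\<close> with the product Bernoulli weights, by
  summing over its finitely many values.\<close>

lemma prob_correct_set:
  assumes "n \<ge> 1"
  shows "prob {\<omega> \<in> space M. P (correct_set \<omega>)} = bern_sum {1..n} p (\<lambda>T. of_bool (P T))"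
proof -
  have "{\<omega> \<in> space M. P (correct_set \<omega>)} =
      (\<Union>T\<in>{T \<in> Pow {1..n}. P T}. {\<omega> \<in> space M. correct_set \<omega> = T})"
    by (auto simp: correct_set_def)
  also have "prob \<dots> = (\<Sum>T\<in>{T \<in> Pow {1..n}. P T}. prob {\<omega> \<in> space M. correct_set \<omega> = T})"
    by (rule finite_measure_finite_Union) (auto simp: disjoint_family_on_def)
  also have "\<dots> = (\<Sum>T\<in>{T \<in> Pow {1..n}. P T}. prod p T * (\<Prod>i\<in>{1..n} - T. 1 - p i))"
    using assms by (intro sum.cong) (auto intro: prob_correct_set_eq)
  also have "\<dots> = bern_sum {1..n} p (\<lambda>T. of_bool (P T))"
    unfolding bern_sum_def by (rule sum.mono_neutral_cong_left) auto
  finally show ?thesis .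
qed

text \<open>The set of correct experts is a measurable function of (X, Y), which is independent of
  the profile; so both events are preimages under the two independent vectors.\<close>

lemma profile_indep_correct_set:
  "prob {\<omega> \<in> space M. (\<forall>i\<in>{1..n}. K i \<omega> = k i) \<and> P (correct_set \<omega>)} =
     prob {\<omega> \<in> space M. \<forall>i\<in>{1..n}. K i \<omega> = k i} * prob {\<omega> \<in> space M. P (correct_set \<omega>)}"
proof -
  let ?A = "Pi\<^sub>M {1..n} (\<lambda>_. count_space (UNIV :: nat set))"
  let ?B = "Pi\<^sub>M {1..n} (\<lambda>_. count_space (UNIV :: int set)) \<Otimes>\<^sub>M count_space (UNIV :: int set)"
  let ?Kv = "\<lambda>\<omega>. \<lambda>i\<in>{1..n}. K i \<omega>" and ?XY = "\<lambda>\<omega>. (\<lambda>i\<in>{1..n}. X i \<omega>, Y \<omega>)"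
  let ?E = "{f \<in> space ?A. \<forall>i\<in>{1..n}. f i = k i}"
  let ?F = "{z \<in> space ?B. P {i \<in> {1..n}. fst z i = snd z}}"
  have E: "?E \<in> sets ?A" by measurable
  have F: "?F \<in> sets ?B"
  proof -
    have "(\<lambda>z. {i \<in> {1..n}. fst z i = snd z}) \<in> measurable ?B (count_space UNIV)"
      by (rule measurable_finite_Collect) auto
    from measurable_sets[OF this, of "{T. P T}"] show ?thesis
      by (simp add: vimage_def Int_def conj_commute)
  qed
  have rv: "?Kv \<in> measurable M ?A" "?XY \<in> measurable M ?B"
    using K_XY_indep by (simp_all add: indep_rv_def)
  have "prob ((?Kv -` ?E \<inter> space M) \<inter> (?XY -` ?F \<inter> space M)) =
      prob (?Kv -` ?E \<inter> space M) * prob (?XY -` ?F \<inter> space M)"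
  proof (rule indep_setD)
    show "indep_set (sigma_sets (space M) {?Kv -` E \<inter> space M | E. E \<in> sets ?A})
        (sigma_sets (space M) {?XY -` E \<inter> space M | E. E \<in> sets ?B})"
      using K_XY_indep by (simp add: indep_rv_def)
  qed (use E F in \<open>blast intro: sigma_sets.Basic\<close>)+
  moreover have "?Kv -` ?E \<inter> space M = {\<omega> \<in> space M. \<forall>i\<in>{1..n}. K i \<omega> = k i}"
    using measurable_space[OF rv(1)] by auto
  moreover have "?XY -` ?F \<inter> space M = {\<omega> \<in> space M. P (correct_set \<omega>)}"
  proof -
    have "{i \<in> {1..n}. fst (?XY \<omega>) i = snd (?XY \<omega>)} = correct_set \<omega>" for \<omega>
      by (auto simp: correct_set_def)
    then show ?thesis
      using measurable_space[OF rv(2)] by auto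
  qed
  moreover have "{\<omega> \<in> space M. \<forall>i\<in>{1..n}. K i \<omega> = k i} \<inter> {\<omega> \<in> space M. P (correct_set \<omega>)} =
      {\<omega> \<in> space M. (\<forall>i\<in>{1..n}. K i \<omega> = k i) \<and> P (correct_set \<omega>)}"
    by auto
  ultimately show ?thesis by simp
qed

lemma f_HC_error_iff_hc_error:
  assumes "\<omega> \<in> space M"
  shows "f_HC n m (\<lambda>i. X i \<omega>) (\<lambda>i. K i \<omega>) \<noteq> ereal (of_int (Y \<omega>)) \<longleftrightarrow>
    hc_error n m (\<lambda>i. K i \<omega>) (correct_set \<omega>)"
proof -
  have t: "w_HC m (\<lambda>j. K j \<omega>) i * ereal (of_int (2 * correct Y X i \<omega> - 1)) =
      w_HC m (\<lambda>j. K j \<omega>) i * ereal (if i \<in> correct_set \<omega> then 1 else - 1)" if "i \<in> {1..n}" for i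
    using that by (simp add: correct_def correct_set_def)
  show ?thesis
    unfolding f_HC_error_iff[OF assms] hc_error_def
    by (simp only: sum.cong[OF refl t] inf_clash_cong[OF t])
qed


section \<open>Averaging over the random profile\<close>

text \<open>The binomial law lives on \<open>{..m i}\<close>; hence, up to a null set, the profile
  takes finitely many values.\<close>

lemma K_AE_le:
  assumes "i \<in> {1..n}" "0 < p i" "p i < 1"
  shows "AE \<omega> in M. K i \<omega> \<le> m i"
proof (rule AE_distrD[where P = "\<lambda>k. k \<le> m i"])
  show "K i \<in> measurable M (count_space UNIV)"
    by (rule random_variables(3)[OF assms(1)])
  show "AE k in distr M (count_space UNIV) (K i). k \<le> m i"
    unfolding K_binomial[OF assms(1)] using assms by (simp add: AE_measure_pmf_iff)
qed

lemma expectation_p_hat_deviation: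
  assumes i: "i \<in> {1..n}" and p: "0 < p i" "p i < 1" and "0 < m i"
  shows "integrable M (\<lambda>\<omega>. \<bar>p i - p_hat m (\<lambda>j. K j \<omega>) i\<bar>)"
    and "expectation (\<lambda>\<omega>. \<bar>p i - p_hat m (\<lambda>j. K j \<omega>) i\<bar>) \<le> 1 / (2 * sqrt (real (m i)))"
proof -
  let ?f = "\<lambda>k. \<bar>p i - real k / real (m i)\<bar>"
  note K = random_variables(3)[OF i]
  have "integrable (distr M (count_space UNIV) (K i)) ?f"
    unfolding K_binomial[OF i] using p by (intro integrable_binomial_pmf) auto
  then show "integrable M (\<lambda>\<omega>. \<bar>p i - p_hat m (\<lambda>j. K j \<omega>) i\<bar>)"
    using K by (simp add: integrable_distr_eq p_hat_def)
  have "expectation (\<lambda>\<omega>. \<bar>p i - p_hat m (\<lambda>j. K j \<omega>) i\<bar>) =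
      integral\<^sup>L (distr M (count_space UNIV) (K i)) ?f"
    using K by (simp add: integral_distr p_hat_def)
  also have "\<dots> \<le> 1 / (2 * sqrt (real (m i)))"
    unfolding K_binomial[OF i] by (rule binomial_mean_abs_deviation[OF p \<open>0 < m i\<close>])
  finally show "expectation (\<lambda>\<omega>. \<bar>p i - p_hat m (\<lambda>j. K j \<omega>) i\<bar>) \<le> 1 / (2 * sqrt (real (m i)))" .
qed

text \<open>Moves from the empirical competences in \<open>empirical_error_le\<close> to the true
  ones, at the cost given by \<open>bern_sum_diff_le\<close>.\<close>

lemma prob_hc_error_le:
  assumes "n \<ge> 1" and p: "\<And>i. i \<in> {1..n} \<Longrightarrow> 0 < p i \<and> p i < 1"
    and mk: "\<And>i. i \<in> {1..n} \<Longrightarrow> 0 < m i \<and> k i \<le> m i"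
    and R: "exp_ereal (hc_exponent n m k) \<le> ereal c" and "0 \<le> c"
  shows "prob {\<omega> \<in> space M. hc_error n m k (correct_set \<omega>)} \<le>
    c + (\<Sum>i=1..n. \<bar>p i - p_hat m k i\<bar>)"
proof -
  let ?f = "\<lambda>T. of_bool (hc_error n m k T)"
  have "bern_sum {1..n} p ?f - bern_sum {1..n} (p_hat m k) ?f \<le> (\<Sum>i=1..n. \<bar>p i - p_hat m k i\<bar>)"
    using p mk by (intro bern_sum_diff_le) (auto simp: p_hat_def less_imp_le)
  then show ?thesis
    using empirical_error_le[OF mk R \<open>0 \<le> c\<close>] prob_correct_set[OF \<open>n \<ge> 1\<close>, of "hc_error n m k"]
    by simp
qed

text \<open>Decomposes the event by the value of the profile, bounds each slice by independence and
  \<open>prob_hc_error_le\<close>, and recombines the bounds into an expectation of absolute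
  deviations.\<close>

lemma prob_confident_error_le:
  assumes "n \<ge> 1" and p: "\<And>i. i \<in> {1..n} \<Longrightarrow> 0 < p i \<and> p i < 1"
    and m: "\<And>i. i \<in> {1..n} \<Longrightarrow> 0 < m i" and "0 \<le> c"
  shows "prob {\<omega> \<in> space M. exp_ereal (hc_exponent n m (\<lambda>i. K i \<omega>)) \<le> ereal c \<and>
      hc_error n m (\<lambda>i. K i \<omega>) (correct_set \<omega>)} \<le>
    c + (\<Sum>i=1..n. 1 / sqrt (real (m i))) / 2"
proof -
  define P where
    "P = (\<lambda>k T. exp_ereal (hc_exponent n m k) \<le> ereal c \<and> hc_error n m k T)"
  define E where "E = {\<omega> \<in> space M. P (\<lambda>i. K i \<omega>) (correct_set \<omega>)}"
  \<comment> \<open>Extensional functions, so that distinct members differ inside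
    \<open>{1..n}\<close> and no profile is counted twice.\<close>
  define \<K> where "\<K> = Pi\<^sub>E {1..n} (\<lambda>i. {..m i})"
  define A where "A = (\<lambda>k. {\<omega> \<in> space M. \<forall>i\<in>{1..n}. K i \<omega> = k i})"
  define g where "g = (\<lambda>k. c + (\<Sum>i=1..n. \<bar>p i - p_hat m k i\<bar>))"
  have "finite \<K>"
    unfolding \<K>_def by (intro finite_PiE) auto
  have [measurable]: "A k \<in> events" for k
    unfolding A_def using random_variables(3) by measurable
  have g_nonneg: "0 \<le> g k" for k
    unfolding g_def using \<open>0 \<le> c\<close> by (intro add_nonneg_nonneg sum_nonneg) auto
  have g_cong: "g k = g k'" if "\<And>i. i \<in> {1..n} \<Longrightarrow> k i = k' i" for k k'
    using that by (simp add: g_def p_hat_def)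
  have P_cong: "P k = P k'" if "\<And>i. i \<in> {1..n} \<Longrightarrow> k i = k' i" for k k'
    unfolding P_def using hc_exponent_cong[OF that] hc_error_cong[OF that] by simp
  have EA: "E \<inter> A k = {\<omega> \<in> space M. (\<forall>i\<in>{1..n}. K i \<omega> = k i) \<and> P k (correct_set \<omega>)}" for k
  proof -
    have "P (\<lambda>i. K i \<omega>) = P k" if "\<forall>i\<in>{1..n}. K i \<omega> = k i" for \<omega>
      by (rule P_cong) (use that in blast)
    then show ?thesis
      by (auto simp: E_def A_def)
  qed
  have EA_le: "prob (E \<inter> A k) \<le> prob (A k) * g k" if "k \<in> \<K>" for k
  proof -
    have "prob {\<omega> \<in> space M. P k (correct_set \<omega>)} \<le> g k"
    \<comment> \<open>For a profile that violates the confidence condition the event is empty, and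
      \<open>0 \<le> g k\<close> suffices.\<close>
    proof (cases "exp_ereal (hc_exponent n m k) \<le> ereal c")
      case True
      have "0 < m i \<and> k i \<le> m i" if "i \<in> {1..n}" for i
        using \<open>k \<in> \<K>\<close> that m by (auto simp: \<K>_def)
      from prob_hc_error_le[OF \<open>n \<ge> 1\<close> p this True \<open>0 \<le> c\<close>] True show ?thesis
        by (simp add: P_def g_def)
    qed (simp add: P_def g_nonneg)
    then show ?thesis
      unfolding EA profile_indep_correct_set by (simp add: A_def mult_left_mono)
  qed
  have EA_events: "E \<inter> A k \<in> events" for k
  proof -
    have "{\<omega> \<in> space M. P k (correct_set \<omega>)} \<in> events"
      using measurable_sets[OF correct_set_measurable, of "{T. P k T}"]
      by (simp add: vimage_def Int_def conj_commute)
    moreover have "E \<inter> A k = A k \<inter> {\<omega> \<in> space M. P k (correct_set \<omega>)}"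
      unfolding EA unfolding A_def by blast
    ultimately show ?thesis by simp
  qed
  have dev_integrable: "integrable M (\<lambda>\<omega>. \<bar>p i - p_hat m (\<lambda>j. K j \<omega>) i\<bar>)"
    if "i \<in> {1..n}" for i
    using expectation_p_hat_deviation(1)[OF that] p[OF that] m[OF that] by blast
  have "AE \<omega> in M. \<forall>i\<in>{1..n}. K i \<omega> \<le> m i"
  proof (rule AE_finite_allI)
    fix i assume i: "i \<in> {1..n}"
    show "AE \<omega> in M. K i \<omega> \<le> m i"
      using p[OF i] by (intro K_AE_le[OF i]) auto
  qed simp
  \<comment> \<open>Almost every point of \<open>E\<close> has its profile, restricted to
    \<open>{1..n}\<close>, in \<open>\<K>\<close>.\<close>
  then have "prob E \<le> prob (\<Union>k\<in>\<K>. E \<inter> A k)"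
  proof (rule finite_measure_mono_AE[OF AE_mp])
    show "AE \<omega> in M. (\<forall>i\<in>{1..n}. K i \<omega> \<le> m i) \<longrightarrow> \<omega> \<in> E \<longrightarrow> \<omega> \<in> (\<Union>k\<in>\<K>. E \<inter> A k)"
    proof (intro AE_I2 impI)
      fix \<omega> assume "\<omega> \<in> space M" "\<forall>i\<in>{1..n}. K i \<omega> \<le> m i" "\<omega> \<in> E"
      then have "(\<lambda>i\<in>{1..n}. K i \<omega>) \<in> \<K>" "\<omega> \<in> E \<inter> A (\<lambda>i\<in>{1..n}. K i \<omega>)"
        by (auto simp: \<K>_def A_def)
      then show "\<omega> \<in> (\<Union>k\<in>\<K>. E \<inter> A k)" by blast
    qed
    show "(\<Union>k\<in>\<K>. E \<inter> A k) \<in> events"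
      using \<open>finite \<K>\<close> EA_events by (intro sets.finite_UN)
  qed
  also have "\<dots> \<le> (\<Sum>k\<in>\<K>. prob (E \<inter> A k))"
    using \<open>finite \<K>\<close> EA_events by (intro finite_measure_subadditive_finite) auto
  also have "\<dots> \<le> (\<Sum>k\<in>\<K>. prob (A k) * g k)"
    by (intro sum_mono EA_le)
  \<comment> \<open>Written as one expectation, the sum can be compared with \<open>g\<close> at the
    random profile pointwise.\<close>
  also have "\<dots> = expectation (\<lambda>\<omega>. \<Sum>k\<in>\<K>. indicator (A k) \<omega> * g k)"
    by (subst Bochner_Integration.integral_sum) (auto simp: emeasure_eq_measure)
  also have "\<dots> \<le> expectation (\<lambda>\<omega>. g (\<lambda>i. K i \<omega>))"
  proof (rule integral_mono)
    show "integrable M (\<lambda>\<omega>. \<Sum>k\<in>\<K>. indicator (A k) \<omega> * g k)"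
      by (auto simp: emeasure_eq_measure)
    show "integrable M (\<lambda>\<omega>. g (\<lambda>i. K i \<omega>))"
      unfolding g_def
      by (intro Bochner_Integration.integrable_add Bochner_Integration.integrable_sum dev_integrable) simp
    fix \<omega> assume \<omega>: "\<omega> \<in> space M"
    let ?k = "\<lambda>i\<in>{1..n}. K i \<omega>"
    \<comment> \<open>Only the term belonging to the profile of \<omega> survives; if that profile
      lies outside \<open>\<K>\<close>, the whole sum is 0.\<close>
    have "indicator (A k) \<omega> * g k = (if k = ?k then g (\<lambda>i. K i \<omega>) else 0)" if "k \<in> \<K>" for k
    proof -
      have k: "k = restrict k {1..n}"
        using that by (simp add: \<K>_def PiE_restrict)
      have "\<omega> \<in> A k \<longleftrightarrow> k = ?k"
      proof
        assume "\<omega> \<in> A k"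
        then have "restrict k {1..n} = ?k"
          by (intro restrict_ext) (simp add: A_def)
        with k show "k = ?k" by simp
      next
        assume "k = ?k"
        then have "\<forall>i\<in>{1..n}. k i = K i \<omega>" by simp
        with \<omega> show "\<omega> \<in> A k" by (simp add: A_def)
      qed
      moreover have "g ?k = g (\<lambda>i. K i \<omega>)"
        by (rule g_cong) simp
      ultimately show ?thesis
        by (cases "k = ?k") simp_all
    qed
    then have "(\<Sum>k\<in>\<K>. indicator (A k) \<omega> * g k) = (if ?k \<in> \<K> then g (\<lambda>i. K i \<omega>) else 0)"
      using \<open>finite \<K>\<close> by (simp add: sum.delta cong: sum.cong)
    then show "(\<Sum>k\<in>\<K>. indicator (A k) \<omega> * g k) \<le> g (\<lambda>i. K i \<omega>)"
      using g_nonneg by simp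
  qed
  also have "\<dots> = c + (\<Sum>i=1..n. expectation (\<lambda>\<omega>. \<bar>p i - p_hat m (\<lambda>j. K j \<omega>) i\<bar>))"
  proof -
    have "expectation (\<lambda>\<omega>. \<Sum>i=1..n. \<bar>p i - p_hat m (\<lambda>j. K j \<omega>) i\<bar>) =
        (\<Sum>i=1..n. expectation (\<lambda>\<omega>. \<bar>p i - p_hat m (\<lambda>j. K j \<omega>) i\<bar>))"
      by (rule Bochner_Integration.integral_sum) (rule dev_integrable)
    moreover have "integrable M (\<lambda>\<omega>. \<Sum>i=1..n. \<bar>p i - p_hat m (\<lambda>j. K j \<omega>) i\<bar>)"
      by (rule Bochner_Integration.integrable_sum) (rule dev_integrable)
    ultimately show ?thesis
      unfolding g_def by (simp add: prob_space)
  qed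
  also have "\<dots> \<le> c + (\<Sum>i=1..n. 1 / (2 * sqrt (real (m i))))"
  proof (rule add_left_mono, rule sum_mono)
    fix i assume i: "i \<in> {1..n}"
    show "expectation (\<lambda>\<omega>. \<bar>p i - p_hat m (\<lambda>j. K j \<omega>) i\<bar>) \<le> 1 / (2 * sqrt (real (m i)))"
      by (rule expectation_p_hat_deviation(2)[OF i]) (use p[OF i] m[OF i] in auto)
  qed
  also have "(\<Sum>i=1..n. 1 / (2 * sqrt (real (m i)))) = (\<Sum>i=1..n. 1 / sqrt (real (m i))) / 2"
    by (simp add: sum_divide_distrib mult.commute)
  finally show ?thesis
    by (simp add: E_def P_def)
qed

end

theorem theorem10:
  fixes M :: "'a measure"
    and n :: nat
    and p :: "nat \<Rightarrow> real"
    and m :: "nat \<Rightarrow> nat"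
    and Y :: "'a \<Rightarrow> int"
    and X :: "nat \<Rightarrow> 'a \<Rightarrow> int"
    and K :: "nat \<Rightarrow> 'a \<Rightarrow> nat"
    and \<delta> :: real
    and R :: "'a set"
  assumes "n \<ge> 1"
    and "\<And>i. i \<in> {1..n} \<Longrightarrow> 0 < p i \<and> p i < 1"
    and "\<And>i. i \<in> {1..n} \<Longrightarrow> 0 < m i"
    and "committee M n p m Y X K"
  defines "\<delta> \<equiv> \<Sum>i=1..n. 1 / sqrt (real (m i))"
    and "R \<equiv> {\<omega> \<in> space M.
      exp_ereal (- (ereal (1/2) *
        (\<Sum>i=1..n. ereal (p_hat m (\<lambda>j. K j \<omega>) i - 1/2) * w_HC m (\<lambda>j. K j \<omega>) i)))
      \<le> ereal (\<delta> / 2)}"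
  shows "measure M (R \<inter> {\<omega> \<in> space M.
      f_HC n m (\<lambda>i. X i \<omega>) (\<lambda>i. K i \<omega>) \<noteq> ereal (of_int (Y \<omega>))}) \<le> \<delta>"
proof -
  interpret committee M n p m Y X K by fact
  have "0 \<le> \<delta> / 2"
    unfolding \<delta>_def by (simp add: sum_nonneg)
  have "R \<inter> {\<omega> \<in> space M. f_HC n m (\<lambda>i. X i \<omega>) (\<lambda>i. K i \<omega>) \<noteq> ereal (of_int (Y \<omega>))} =
      {\<omega> \<in> space M. exp_ereal (hc_exponent n m (\<lambda>i. K i \<omega>)) \<le> ereal (\<delta> / 2) \<and>
        hc_error n m (\<lambda>i. K i \<omega>) (correct_set \<omega>)}"
    using f_HC_error_iff_hc_error by (auto simp: R_def hc_exponent_def)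
  \<comment> \<open>One half of \<delta> is the confidence threshold \<open>c\<close>, the other the
    mean deviation of the empirical competences.\<close>
  also have "prob \<dots> \<le> \<delta> / 2 + \<delta> / 2"
    unfolding \<delta>_def
    by (rule prob_confident_error_le) (use assms(1-3) \<open>0 \<le> \<delta> / 2\<close> in \<open>auto simp: \<delta>_def\<close>)
  finally show ?thesis by simp
qed

end
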